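(* Fix $\alpha,\delta\in(0,1)$, $s\in(0,1]$, $\lambda\in[s,1)$. Consider any sequence of models $(\mathbf P^{(m)})_{m\ge1}$ in the pre-ordered setting, and let $\hat r_\alpha$ be the number of rejections of the Lei–Fithian (LF) procedure with parameters $s,\lambda$ at level $\alpha$. Define $$\overline{\mathrm{FDP}}^{\mathrm{Freed}}_\alpha=1\wedge\left(\alpha+\frac{\Delta(\nu\hat k_\alpha)}{1\vee\hat r_\alpha}\right),\qquad \overline{\mathrm{FDP}}^{\mathrm{KR\text{-}U}}_\alpha=1\wedge\min_{1\le a\le1\vee\hat r_\alpha}\left\{\frac{\log(1/\delta_a)}{a\log\Bigl(1+\frac{1-\delta_a^{B/a}}{B}\Bigr)}\left(\alpha+\frac{a}{1\vee\hat r_\alpha}\right)\right\}$$ (minimum over integers $a$). Then, as $m\to\infty$: - $\overline{\mathrm{FDP}}^{\mathrm{Freed}}_\alpha$ is LF $m$-consistent if $(m\log\log m)^{1/2}/\hat r_\alpha=o_P(1)$; - $\overline{\mathrm{FDP}}^{\mathrm{KR\text{-}U}}_\alpha$ is LF $m$-consistent if $1/\hat r_\alpha=o_P(1)$. Here a bound $\overline{\mathrm{FDP}}_\alpha$ is LF $m$-consistent if for all $\epsilon>0$, $\lim_{m\to\infty}\mathbf P^{(m)}(\overline{\mathrm{FDP}}_\alpha-\alpha\ge\epsilon)=0$.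
   Context: Pre-ordered setting, for each $m$: under $\mathbf P^{(m)}$, $p_1,\dots,p_m\in[0,1]$ are independent, with a set of true nulls $\mathcal H_0\subset\{1,\dots,m\}$ such that $p_i\sim U(0,1)$ for $i\in\mathcal H_0$, and $\pi$ is a deterministic permutation of $\{1,\dots,m\}$. The LF procedure with parameters $s,\lambda$ at level $\alpha$ is $$\hat k_\alpha=\max\{k\in\{0,\dots,m\}:\widehat{\mathrm{FDP}}_k\le\alpha\},\qquad \widehat{\mathrm{FDP}}_k=\frac{s}{1-\lambda}\cdot\frac{1+\sum_{i=1}^k\mathbf 1\{p_{\pi(i)}>\lambda\}}{1\vee\sum_{i=1}^k\mathbf 1\{p_{\pi(i)}\le s\}}$$ ($\hat k_\alpha=0$ if the set is empty); it rejects $\{\pi(i):i\le\hat k_\alpha,\ p_{\pi(i)}\le s\}$, so $\hat r_\alpha=\sum_{i=1}^{\hat k_\alpha}\mathbf 1\{p_{\pi(i)}\le s\}$. Notation: $\kappa=\pi_\circ^2/6$ with $\pi_\circ=3.14159\ldots$; $\delta_a=\delta/(\kappa a^2)$; $B=s/(1-\lambda)$; $\nu=s(1+s/(1-\lambda))$; $\Delta(u)=2\sqrt{\varepsilon_u}\sqrt{u\vee1}+\frac12\varepsilon_u$ with $\varepsilon_u=\log((1+\kappa)/\delta)+2\log(1+\log_2(u\vee1))$. $o_P(1)$ is convergence to $0$ in $\mathbf P^{(m)}$-probability (with $1/0=+\infty$). *)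

theory Defs
  imports "HOL-Probability.Probability"
begin

text \<open>Pre-ordered setting with \<open>m\<close> hypotheses indexed by \<open>{1..m}\<close>: the permutation \<open>\<pi>\<close> is
  deterministic, and only the p-values of the true nulls \<open>H0\<close> have a prescribed distribution.
  (\<open>\<pi>\<close> is a variable; the real number is \<^const>\<open>pi\<close>.)\<close>

locale preordered_model = prob_space M for M :: "'a measure" +
  fixes m :: nat and p :: "nat \<Rightarrow> 'a \<Rightarrow> real" and H0 :: "nat set" and \<pi> :: "nat \<Rightarrow> nat"
  assumes indep: "indep_vars (\<lambda>_. borel) p {1..m}"
    and range: "\<And>i \<omega>. i \<in> {1..m} \<Longrightarrow> \<omega> \<in> space M \<Longrightarrow> p i \<omega> \<in> {0..1}"
    and nulls: "H0 \<subseteq> {1..m}"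
    and null_uniform: "\<And>i. i \<in> H0 \<Longrightarrow> distr M borel (p i) = uniform_measure lborel {0..1}"
    and perm: "\<pi> permutes {1..m}"

text \<open>The Lei--Fithian procedure, applied to a realised vector \<open>q\<close> of p-values.\<close>

definition LF_fdp_hat :: "real \<Rightarrow> real \<Rightarrow> (nat \<Rightarrow> nat) \<Rightarrow> (nat \<Rightarrow> real) \<Rightarrow> nat \<Rightarrow> real" where
  "LF_fdp_hat s lam \<pi> q k =
     s / (1 - lam) * ((1 + (\<Sum>i=1..k. of_bool (q (\<pi> i) > lam)))
                      / max 1 (\<Sum>i=1..k. of_bool (q (\<pi> i) \<le> s)))"

definition LF_khat ::
    "real \<Rightarrow> real \<Rightarrow> real \<Rightarrow> nat \<Rightarrow> (nat \<Rightarrow> nat) \<Rightarrow> (nat \<Rightarrow> real) \<Rightarrow> nat" where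
  "LF_khat \<alpha> s lam m \<pi> q =
     (let K = {k \<in> {0..m}. LF_fdp_hat s lam \<pi> q k \<le> \<alpha>} in if K = {} then 0 else Max K)"

definition LF_rhat ::
    "real \<Rightarrow> real \<Rightarrow> real \<Rightarrow> nat \<Rightarrow> (nat \<Rightarrow> nat) \<Rightarrow> (nat \<Rightarrow> real) \<Rightarrow> nat" where
  "LF_rhat \<alpha> s lam m \<pi> q = (\<Sum>i=1..LF_khat \<alpha> s lam m \<pi> q. of_bool (q (\<pi> i) \<le> s))"

definition kappa :: real where
  "kappa = pi\<^sup>2 / 6"

definition delta_at :: "real \<Rightarrow> nat \<Rightarrow> real" where
  "delta_at \<delta> a = \<delta> / (kappa * (real a)\<^sup>2)"

definition eps_at :: "real \<Rightarrow> real \<Rightarrow> real" where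
  "eps_at \<delta> u = ln ((1 + kappa) / \<delta>) + 2 * ln (1 + log 2 (max u 1))"

definition Delta :: "real \<Rightarrow> real \<Rightarrow> real" where
  "Delta \<delta> u = 2 * sqrt (eps_at \<delta> u) * sqrt (max u 1) + 1 / 2 * eps_at \<delta> u"

definition FDP_Freed ::
    "real \<Rightarrow> real \<Rightarrow> real \<Rightarrow> real \<Rightarrow> nat \<Rightarrow> (nat \<Rightarrow> nat) \<Rightarrow> (nat \<Rightarrow> real) \<Rightarrow> real" where
  "FDP_Freed \<alpha> \<delta> s lam m \<pi> q =
     (let \<nu> = s * (1 + s / (1 - lam));
          k = LF_khat \<alpha> s lam m \<pi> q;
          r = LF_rhat \<alpha> s lam m \<pi> q
      in min 1 (\<alpha> + Delta \<delta> (\<nu> * real k) / max 1 (real r)))"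

definition FDP_KRU ::
    "real \<Rightarrow> real \<Rightarrow> real \<Rightarrow> real \<Rightarrow> nat \<Rightarrow> (nat \<Rightarrow> nat) \<Rightarrow> (nat \<Rightarrow> real) \<Rightarrow> real" where
  "FDP_KRU \<alpha> \<delta> s lam m \<pi> q =
     (let B = s / (1 - lam);
          r = LF_rhat \<alpha> s lam m \<pi> q
      in min 1 (MIN a \<in> {1..max 1 r}.
           ln (1 / delta_at \<delta> a)
             / (real a * ln (1 + (1 - delta_at \<delta> a powr (B / real a)) / B))
           * (\<alpha> + real a / max 1 (real r))))"

text \<open>Extended real values, so that \<open>1 / 0 = \<infinity>\<close>.\<close>

definition little_o_P_1 :: "(nat \<Rightarrow> 'a measure) \<Rightarrow> (nat \<Rightarrow> 'a \<Rightarrow> ereal) \<Rightarrow> bool" where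
  "little_o_P_1 M X \<longleftrightarrow>
     (\<forall>\<epsilon>>0. (\<lambda>m. measure (M m) {\<omega> \<in> space (M m). \<bar>X m \<omega>\<bar> > ereal \<epsilon>}) \<longlonglongrightarrow> 0)"

definition LF_m_consistent ::
    "(nat \<Rightarrow> 'a measure) \<Rightarrow> real \<Rightarrow> (nat \<Rightarrow> 'a \<Rightarrow> real) \<Rightarrow> bool" where
  "LF_m_consistent M \<alpha> F \<longleftrightarrow>
     (\<forall>\<epsilon>>0. (\<lambda>m. measure (M m) {\<omega> \<in> space (M m). F m \<omega> - \<alpha> \<ge> \<epsilon>}) \<longlonglongrightarrow> 0)"

end

theory Submission
  imports Defs "HOL-Real_Asymp.Real_Asymp"
begin

text \<open>Both bounds are controlled pathwise. For the Freedman bound, \<open>Delta\<close> is increasing and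
  \<open>k \<le> m\<close>, so the excess over \<open>\<alpha>\<close> is at most \<open>Delta (\<nu> m) / r = O(sqrt (m log log m)) / r\<close>.
  For the KR-U bound, the prefactor of the \<open>a\<close>-th term tends to 1 as \<open>a \<rightarrow> \<infinity>\<close>; fix \<open>a\<close> with the
  prefactor close to 1, and then \<open>a / r\<close> is negligible once \<open>r\<close> is large.\<close>

section \<open>The stopping index and the number of rejections as random variables\<close>

lemma LF_khat_le: "LF_khat \<alpha> s lam m \<pi> q \<le> m"
proof -
  let ?K = "{k \<in> {0..m}. LF_fdp_hat s lam \<pi> q k \<le> \<alpha>}"
  have "Max ?K \<in> ?K" if "?K \<noteq> {}"
    using that by (intro Max_in) auto
  then show ?thesis
    unfolding LF_khat_def Let_def by auto
qed

text \<open>Serves measurability: each level set of the stopping index becomes a finite Boolean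
  combination of comparisons with \<alpha>. The second disjunct is the default value 0 for an empty
  candidate set.\<close>

lemma LF_khat_eq_iff:
  "LF_khat \<alpha> s lam m \<pi> q = k \<longleftrightarrow>
     (k \<le> m \<and> LF_fdp_hat s lam \<pi> q k \<le> \<alpha> \<and> (\<forall>j\<in>{k<..m}. \<not> LF_fdp_hat s lam \<pi> q j \<le> \<alpha>)) \<or>
     (k = 0 \<and> (\<forall>j\<in>{..m}. \<not> LF_fdp_hat s lam \<pi> q j \<le> \<alpha>))"
proof (cases "{k \<in> {0..m}. LF_fdp_hat s lam \<pi> q k \<le> \<alpha>} = {}")
  case True
  then have "LF_khat \<alpha> s lam m \<pi> q = 0"
    unfolding LF_khat_def Let_def by simp
  then show ?thesis using True by auto
next
  case False
  let ?K = "{k \<in> {0..m}. LF_fdp_hat s lam \<pi> q k \<le> \<alpha>}"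
  have "LF_khat \<alpha> s lam m \<pi> q = Max ?K"
    unfolding LF_khat_def Let_def using False by (rule if_not_P)
  moreover have "Max ?K = k \<longleftrightarrow> k \<in> ?K \<and> (\<forall>j\<in>?K. j \<le> k)"
    using False by (intro Max_eq_iff) auto
  ultimately show ?thesis using False by (auto simp: not_less[symmetric])
qed

context preordered_model
begin

lemma measurable_p_perm:
  assumes "i \<in> {1..m}"
  shows "p (\<pi> i) \<in> borel_measurable M"
proof -
  have "\<pi> i \<in> {1..m}"
    using permutes_in_image[OF perm, of i] assms by blast
  then show ?thesis
    using indep by (auto simp: indep_vars_def)
qed

lemma measurable_LF_khat:
  "(\<lambda>\<omega>. LF_khat \<alpha> s lam m \<pi> (\<lambda>i. p i \<omega>)) \<in> measurable M (count_space UNIV)"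
proof -
  have fdp: "(\<lambda>\<omega>. LF_fdp_hat s lam \<pi> (\<lambda>i. p i \<omega>) k) \<in> borel_measurable M" if "k \<le> m" for k
  proof -
    have [measurable]: "p (\<pi> i) \<in> borel_measurable M" if "i \<in> {1..k}" for i
      using that \<open>k \<le> m\<close> by (intro measurable_p_perm) auto
    show ?thesis unfolding LF_fdp_hat_def by measurable
  qed
  have [measurable]: "Measurable.pred M (\<lambda>\<omega>. LF_fdp_hat s lam \<pi> (\<lambda>i. p i \<omega>) k \<le> \<alpha>)"
    if "k \<le> m" for k
    using fdp[OF that] by measurable
  have pred: "Measurable.pred M (\<lambda>\<omega>. LF_khat \<alpha> s lam m \<pi> (\<lambda>i. p i \<omega>) = k)" for k
  proof (cases "k \<le> m")
    case True
    then show ?thesis unfolding LF_khat_eq_iff by measurable auto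
  next
    case False
    then have "LF_khat \<alpha> s lam m \<pi> q \<noteq> k" for q
      using LF_khat_le[of \<alpha> s lam m \<pi> q] by auto
    then show ?thesis by simp
  qed
  \<comment> \<open>The values are countable, so measurability of the fibres suffices.\<close>
  show ?thesis
    using pred by (subst measurable_count_space_eq2_countable)
      (auto simp: pred_def vimage_def Int_def conj_commute)
qed

lemma measurable_LF_rhat:
  "(\<lambda>\<omega>. LF_rhat \<alpha> s lam m \<pi> (\<lambda>i. p i \<omega>)) \<in> measurable M (count_space UNIV)"
proof -
  note measurable_LF_khat[measurable]
  \<comment> \<open>The random upper limit of the sum moves into the summand, leaving a sum over a
    fixed range.\<close>
  have eq: "LF_rhat \<alpha> s lam m \<pi> q =
      (\<Sum>i=1..m. of_bool (i \<le> LF_khat \<alpha> s lam m \<pi> q \<and> q (\<pi> i) \<le> s))" for q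
    unfolding LF_rhat_def
    using LF_khat_le[of \<alpha> s lam m \<pi> q] by (intro sum.mono_neutral_cong_left) auto
  have [measurable]: "p (\<pi> i) \<in> borel_measurable M" if "i \<in> {1..m}" for i
    using that by (rule measurable_p_perm)
  show ?thesis unfolding eq by measurable
qed

end

text \<open>The consistency event need not be shown measurable: a non-measurable set has measure 0.\<close>

lemma LF_m_consistentI:
  assumes X: "little_o_P_1 M X"
    and fin: "\<And>m. m \<ge> 1 \<Longrightarrow> finite_measure (M m)"
    and meas: "\<And>m \<eta>. m \<ge> 1 \<Longrightarrow> {\<omega> \<in> space (M m). \<bar>X m \<omega>\<bar> > ereal \<eta>} \<in> sets (M m)"
    and bound: "\<And>\<epsilon>. \<epsilon> > 0 \<Longrightarrow>
      \<exists>\<eta>>0. \<forall>\<^sub>F m in sequentially. \<forall>\<omega>. \<bar>X m \<omega>\<bar> \<le> ereal \<eta> \<longrightarrow> F m \<omega> - \<alpha> < \<epsilon>"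
  shows "LF_m_consistent M \<alpha> F"
  unfolding LF_m_consistent_def
proof (intro allI impI)
  fix \<epsilon> :: real assume "\<epsilon> > 0"
  then obtain \<eta> where "\<eta> > 0"
    and ev: "\<forall>\<^sub>F m in sequentially. \<forall>\<omega>. \<bar>X m \<omega>\<bar> \<le> ereal \<eta> \<longrightarrow> F m \<omega> - \<alpha> < \<epsilon>"
    using bound by blast
  let ?A = "\<lambda>m. {\<omega> \<in> space (M m). F m \<omega> - \<alpha> \<ge> \<epsilon>}"
  let ?B = "\<lambda>m. {\<omega> \<in> space (M m). \<bar>X m \<omega>\<bar> > ereal \<eta>}"
  have lim: "(\<lambda>m. measure (M m) (?B m)) \<longlonglongrightarrow> 0"
    using X \<open>\<eta> > 0\<close> unfolding little_o_P_1_def by blast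
  have le: "\<forall>\<^sub>F m in sequentially. measure (M m) (?A m) \<le> measure (M m) (?B m)"
    using ev eventually_ge_at_top[of 1]
  proof eventually_elim
    case (elim m)
    interpret finite_measure "M m" using fin elim(2) by blast
    have "?A m \<subseteq> ?B m" using elim(1) by (fastforce simp: not_le[symmetric])
    then show ?case
      using meas[OF elim(2)] by (intro finite_measure_mono) auto
  qed
  show "(\<lambda>m. measure (M m) (?A m)) \<longlonglongrightarrow> 0"
    by (rule tendsto_sandwich[OF _ le tendsto_const lim]) simp
qed

section \<open>Deterministic asymptotics: growth of \<open>Delta\<close> and limit of the KR-U
  prefactor\<close>

lemma eps_at_nonneg:
  assumes "0 < \<delta>" "\<delta> < 1"
  shows "eps_at \<delta> u \<ge> 0"
proof -
  \<comment> \<open>This follows from \<open>\<delta> < 1 \<le> 1 + kappa\<close>.\<close>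
  have "(1 + kappa) / \<delta> \<ge> 1"
    using assms by (simp add: kappa_def field_simps add_increasing2)
  then have "ln ((1 + kappa) / \<delta>) \<ge> 0" by simp
  moreover have "ln (1 + log 2 (max u 1)) \<ge> 0" by simp
  ultimately show ?thesis unfolding eps_at_def by linarith
qed

lemma eps_at_mono: "u \<le> v \<Longrightarrow> eps_at \<delta> u \<le> eps_at \<delta> v"
  unfolding eps_at_def by (auto simp: add_pos_nonneg)

text \<open>Allows the random argument of \<open>Delta\<close> to be replaced by a deterministic
  one. Nonnegativity of \<open>eps_at\<close> keeps the square roots nonnegative, as monotonicity of
  their product requires.\<close>

lemma Delta_mono:
  assumes "0 < \<delta>" "\<delta> < 1" "u \<le> v"
  shows "Delta \<delta> u \<le> Delta \<delta> v"
  unfolding Delta_def using assms eps_at_mono[of u v \<delta>] eps_at_nonneg[of \<delta>]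
  by (intro add_mono mult_mono) auto

text \<open>Here \<open>eps_at\<close> grows like \<open>2 * ln (ln m)\<close>, so the product of
  square roots has the stated order and the additive \<open>eps_at\<close> term is of lower
  order.\<close>

lemma Delta_bigo:
  assumes "\<nu> > 0"
  shows "(\<lambda>m. Delta \<delta> (\<nu> * real m)) \<in> O(\<lambda>m. sqrt (real m * ln (ln (real m))))"
proof -
  \<comment> \<open>Eventually the truncation \<open>max u 1\<close> disappears, leaving an explicit
    expression in m.\<close>
  have "\<forall>\<^sub>F m in sequentially. \<nu> * real m \<ge> 1"
    using assms by real_asymp
  then have "\<forall>\<^sub>F m in sequentially. Delta \<delta> (\<nu> * real m) =
      2 * sqrt (ln ((1 + kappa) / \<delta>) + 2 * ln (1 + log 2 (\<nu> * real m))) * sqrt (\<nu> * real m)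
        + 1 / 2 * (ln ((1 + kappa) / \<delta>) + 2 * ln (1 + log 2 (\<nu> * real m)))"
    by eventually_elim (simp add: Delta_def eps_at_def max_absorb1)
  \<comment> \<open>The constant involving \<delta> is abstracted to an arbitrary \<open>c\<close>;
    the iterated logarithm dominates it whatever its value.\<close>
  moreover have "(\<lambda>m. 2 * sqrt (c + 2 * ln (1 + log 2 (\<nu> * real m))) * sqrt (\<nu> * real m)
        + 1 / 2 * (c + 2 * ln (1 + log 2 (\<nu> * real m))))
      \<in> O(\<lambda>m. sqrt (real m * ln (ln (real m))))" for c :: real
    using assms by real_asymp
  ultimately show ?thesis
    by (subst landau_o.big.in_cong)
qed

text \<open>The deterministic multiplier of \<open>\<alpha> + a / r\<close> in the a-th term of the
  KR-U minimum.\<close>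

definition KRU_factor :: "real \<Rightarrow> real \<Rightarrow> nat \<Rightarrow> real" where
  "KRU_factor \<delta> B a =
     ln (1 / delta_at \<delta> a) / (real a * ln (1 + (1 - delta_at \<delta> a powr (B / real a)) / B))"

text \<open>Put \<open>L = ln (1 / delta_at \<delta> a)\<close>, which is of order
  \<open>ln a\<close>. Then \<open>delta_at \<delta> a powr (B / a) = exp (- B * L / a)\<close>, so
  \<open>(1 - exp (- B * L / a)) / B\<close> is asymptotic to \<open>L / a\<close>, and so is the
  logarithm of 1 plus it. The denominator is thus asymptotic to \<open>L\<close>, the
  numerator.\<close>

lemma KRU_factor_tendsto_1:
  assumes "0 < \<delta>" "0 < B"
  shows "KRU_factor \<delta> B \<longlonglongrightarrow> 1"
proof -
  have "c > 0 \<Longrightarrow> (\<lambda>a. ln (1 / (\<delta> / (c * (real a)\<^sup>2)))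
      / (real a * ln (1 + (1 - (\<delta> / (c * (real a)\<^sup>2)) powr (B / real a)) / B))) \<longlonglongrightarrow> 1" for c
    using assms by real_asymp
  moreover have "kappa > 0" by (simp add: kappa_def)
  ultimately show ?thesis
    unfolding KRU_factor_def delta_at_def by blast
qed

text \<open>At \<open>r = 0\<close> the quotient is infinite, so a finite threshold forces
  \<open>r > 0\<close>. Positivity of \<open>x\<close> excludes the case 0 / 0, which is 0 in
  \<open>ereal\<close>.\<close>

lemma ereal_divide_nat_le_iff:
  assumes "x > 0"
  shows "\<bar>ereal x / ereal (real r)\<bar> \<le> ereal \<eta> \<longleftrightarrow> r > 0 \<and> x / real r \<le> \<eta>"
  using assms by (cases "r = 0") (auto simp: divide_ereal_def divide_inverse)

text \<open>Truncation at 1 only lowers the bound, and \<open>Delta_mono\<close> applies because the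
  stopping index is at most \<open>m\<close>.\<close>

lemma FDP_Freed_excess_le:
  assumes "0 < \<delta>" "\<delta> < 1" "s \<ge> 0" "lam < 1" "LF_rhat \<alpha> s lam m \<pi> q > 0"
  shows "FDP_Freed \<alpha> \<delta> s lam m \<pi> q - \<alpha> \<le>
    Delta \<delta> (s * (1 + s / (1 - lam)) * real m) / real (LF_rhat \<alpha> s lam m \<pi> q)"
proof -
  have "Delta \<delta> (s * (1 + s / (1 - lam)) * real (LF_khat \<alpha> s lam m \<pi> q))
      \<le> Delta \<delta> (s * (1 + s / (1 - lam)) * real m)"
    using assms LF_khat_le[of \<alpha> s lam m \<pi> q] by (intro Delta_mono mult_left_mono) auto
  then show ?thesis
    using assms unfolding FDP_Freed_def Let_def
    by (auto simp: min_def max_def divide_right_mono field_simps intro: order_trans)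
qed

text \<open>A minimum is at most its value at any admissible index, which leaves \<open>a\<close>
  free to be chosen later.\<close>

lemma FDP_KRU_le:
  assumes "1 \<le> a" "a \<le> LF_rhat \<alpha> s lam m \<pi> q"
  shows "FDP_KRU \<alpha> \<delta> s lam m \<pi> q \<le>
    KRU_factor \<delta> (s / (1 - lam)) a * (\<alpha> + real a / real (LF_rhat \<alpha> s lam m \<pi> q))"
proof -
  let ?r = "LF_rhat \<alpha> s lam m \<pi> q"
  have "(MIN a \<in> {1..max 1 ?r}. KRU_factor \<delta> (s / (1 - lam)) a * (\<alpha> + real a / max 1 (real ?r)))
      \<le> KRU_factor \<delta> (s / (1 - lam)) a * (\<alpha> + real a / max 1 (real ?r))"
    using assms by (intro Min_le) auto
  moreover have "max 1 (real ?r) = real ?r" using assms by simp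
  ultimately show ?thesis
    unfolding FDP_KRU_def Let_def KRU_factor_def[symmetric] by simp
qed

theorem proposition21:
  fixes \<alpha> \<delta> s lam :: real
    and M :: "nat \<Rightarrow> 'a measure"
    and p :: "nat \<Rightarrow> nat \<Rightarrow> 'a \<Rightarrow> real"
    and H0 :: "nat \<Rightarrow> nat set"
    and \<pi> :: "nat \<Rightarrow> nat \<Rightarrow> nat"
  assumes "0 < \<alpha>" "\<alpha> < 1" and "0 < \<delta>" "\<delta> < 1"
    and "0 < s" "s \<le> 1" and "s \<le> lam" "lam < 1"
    and model: "\<And>m. m \<ge> 1 \<Longrightarrow> preordered_model (M m) m (p m) (H0 m) (\<pi> m)"
  defines "rhat \<equiv> \<lambda>m \<omega>. LF_rhat \<alpha> s lam m (\<pi> m) (\<lambda>i. p m i \<omega>)"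
  shows "(little_o_P_1 M (\<lambda>m \<omega>. ereal (sqrt (real m * ln (ln (real m)))) / ereal (real (rhat m \<omega>)))
           \<longrightarrow> LF_m_consistent M \<alpha> (\<lambda>m \<omega>. FDP_Freed \<alpha> \<delta> s lam m (\<pi> m) (\<lambda>i. p m i \<omega>)))
       \<and> (little_o_P_1 M (\<lambda>m \<omega>. 1 / ereal (real (rhat m \<omega>)))
           \<longrightarrow> LF_m_consistent M \<alpha> (\<lambda>m \<omega>. FDP_KRU \<alpha> \<delta> s lam m (\<pi> m) (\<lambda>i. p m i \<omega>)))"
proof -
  have fin: "finite_measure (M m)" if "m \<ge> 1" for m
  proof -
    interpret preordered_model "M m" m "p m" "H0 m" "\<pi> m" by (rule model[OF that])
    show ?thesis by unfold_locales
  qed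
  \<comment> \<open>An arbitrary predicate \<open>P\<close> on \<open>rhat\<close> covers the tail
    events of both rates.\<close>
  have meas: "{\<omega> \<in> space (M m). P (rhat m \<omega>)} \<in> sets (M m)" if "m \<ge> 1" for m P
  proof -
    interpret preordered_model "M m" m "p m" "H0 m" "\<pi> m" by (rule model[OF that])
    have [measurable]: "rhat m \<in> measurable (M m) (count_space UNIV)"
      unfolding rhat_def by (rule measurable_LF_rhat)
    show ?thesis by measurable
  qed
  have freed: "\<exists>\<eta>>0. \<forall>\<^sub>F m in sequentially. \<forall>\<omega>.
      \<bar>ereal (sqrt (real m * ln (ln (real m)))) / ereal (real (rhat m \<omega>))\<bar> \<le> ereal \<eta> \<longrightarrow>
      FDP_Freed \<alpha> \<delta> s lam m (\<pi> m) (\<lambda>i. p m i \<omega>) - \<alpha> < \<epsilon>" if "\<epsilon> > 0" for \<epsilon>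
  proof -
    define \<nu> where "\<nu> = s * (1 + s / (1 - lam))"
    have "\<nu> > 0" using assms by (simp add: \<nu>_def add_pos_nonneg)
    from landau_o.bigE[OF Delta_bigo[OF this, of \<delta>]] obtain C where "C > 0"
      and C: "\<forall>\<^sub>F m in sequentially.
        norm (Delta \<delta> (\<nu> * real m)) \<le> C * norm (sqrt (real m * ln (ln (real m))))"
      by blast
    \<comment> \<open>For small m, \<open>ln (ln m)\<close> is not positive, so the extended
      quotient is interpreted only eventually.\<close>
    have pos: "\<forall>\<^sub>F m in sequentially. sqrt (real m * ln (ln (real m))) > 0"
      by real_asymp
    \<comment> \<open>The threshold \<open>\<epsilon> / (2 * C)\<close> bounds the excess by
      \<open>\<epsilon> / 2\<close>, which gives the strict inequality.\<close>
    have "\<forall>\<^sub>F m in sequentially. \<forall>\<omega>.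
      \<bar>ereal (sqrt (real m * ln (ln (real m)))) / ereal (real (rhat m \<omega>))\<bar> \<le> ereal (\<epsilon> / (2 * C)) \<longrightarrow>
      FDP_Freed \<alpha> \<delta> s lam m (\<pi> m) (\<lambda>i. p m i \<omega>) - \<alpha> < \<epsilon>"
      using C pos
    proof eventually_elim
      case (elim m)
      define S where "S = sqrt (real m * ln (ln (real m)))"
      show ?case unfolding S_def[symmetric]
      proof (intro allI impI)
        fix \<omega>
        assume "\<bar>ereal S / ereal (real (rhat m \<omega>))\<bar> \<le> ereal (\<epsilon> / (2 * C))"
        then have r: "rhat m \<omega> > 0" and S: "S / real (rhat m \<omega>) \<le> \<epsilon> / (2 * C)"
          using elim(2) ereal_divide_nat_le_iff[of S] by (auto simp: S_def)
        have "FDP_Freed \<alpha> \<delta> s lam m (\<pi> m) (\<lambda>i. p m i \<omega>) - \<alpha>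
            \<le> Delta \<delta> (\<nu> * real m) / real (rhat m \<omega>)"
          using r assms(3-8) unfolding rhat_def \<nu>_def by (intro FDP_Freed_excess_le) auto
        also have "\<dots> \<le> C * S / real (rhat m \<omega>)"
          using elim by (intro divide_right_mono) (auto simp: S_def)
        also have "\<dots> \<le> C * (\<epsilon> / (2 * C))"
          using mult_left_mono[OF S, of C] \<open>C > 0\<close> by simp
        also have "\<dots> < \<epsilon>" using \<open>C > 0\<close> \<open>\<epsilon> > 0\<close> by simp
        finally show "FDP_Freed \<alpha> \<delta> s lam m (\<pi> m) (\<lambda>i. p m i \<omega>) - \<alpha> < \<epsilon>" .
      qed
    qed
    then show ?thesis
      using \<open>C > 0\<close> \<open>\<epsilon> > 0\<close> by (intro exI[of _ "\<epsilon> / (2 * C)"]) simp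
  qed
  have kru: "\<exists>\<eta>>0. \<forall>\<^sub>F m in sequentially. \<forall>\<omega>.
      \<bar>1 / ereal (real (rhat m \<omega>))\<bar> \<le> ereal \<eta> \<longrightarrow>
      FDP_KRU \<alpha> \<delta> s lam m (\<pi> m) (\<lambda>i. p m i \<omega>) - \<alpha> < \<epsilon>" if "\<epsilon> > 0" for \<epsilon>
  proof -
    define f where "f = KRU_factor \<delta> (s / (1 - lam))"
    have lim: "f \<longlonglongrightarrow> 1"
      unfolding f_def using assms by (intro KRU_factor_tendsto_1) auto
    \<comment> \<open>The index \<open>a\<close> depends on \<epsilon> but not on m or \<omega>. The
      bound 2 controls the term with \<open>a / r\<close>; the bound
      \<open>1 + \<epsilon> / 2\<close> controls the term with \<alpha>.\<close>
    have "\<forall>\<^sub>F a in sequentially. f a < min 2 (1 + \<epsilon> / 2) \<and> 0 < f a \<and> 1 \<le> a"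
      using order_tendstoD(2)[OF lim, of "min 2 (1 + \<epsilon> / 2)"] order_tendstoD(1)[OF lim, of 0] that
      by (intro eventually_conj eventually_ge_at_top) auto
    then obtain a where a: "f a < 2" "f a < 1 + \<epsilon> / 2" "0 < f a" "1 \<le> a"
      unfolding eventually_sequentially by auto
    \<comment> \<open>With this threshold, \<open>1 / r \<le> \<eta>\<close> yields both
      \<open>a \<le> r\<close>, so that \<open>a\<close> is admissible in the minimum, and
      \<open>a / r \<le> \<epsilon> / 4\<close>.\<close>
    define \<eta> where "\<eta> = min 1 (\<epsilon> / 4) / real a"
    have "\<eta> > 0" using a that by (simp add: \<eta>_def)
    have "FDP_KRU \<alpha> \<delta> s lam m (\<pi> m) (\<lambda>i. p m i \<omega>) - \<alpha> < \<epsilon>"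
      if "\<bar>1 / ereal (real (rhat m \<omega>))\<bar> \<le> ereal \<eta>" for m \<omega>
    proof -
      have r: "rhat m \<omega> > 0" and "1 / real (rhat m \<omega>) \<le> \<eta>"
        using that ereal_divide_nat_le_iff[of 1] by (auto simp: one_ereal_def)
      then have "real a / real (rhat m \<omega>) \<le> min 1 (\<epsilon> / 4)"
        using a mult_left_mono[of "1 / real (rhat m \<omega>)" \<eta> "real a"] by (simp add: \<eta>_def)
      then have ar: "real a / real (rhat m \<omega>) \<le> 1" "real a / real (rhat m \<omega>) \<le> \<epsilon> / 4"
        by auto
      then have "a \<le> rhat m \<omega>" using r by (simp add: field_simps)
      then have "FDP_KRU \<alpha> \<delta> s lam m (\<pi> m) (\<lambda>i. p m i \<omega>)
          \<le> f a * (\<alpha> + real a / real (rhat m \<omega>))"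
        using a unfolding rhat_def f_def by (intro FDP_KRU_le) auto
      \<comment> \<open>Each summand contributes at most \<open>\<epsilon> / 2\<close> to the
        excess; the first does so because \<open>\<alpha> < 1\<close>.\<close>
      also have "\<dots> = f a * \<alpha> + f a * (real a / real (rhat m \<omega>))"
        by (simp add: distrib_left)
      also have "f a * (real a / real (rhat m \<omega>)) \<le> 2 * (\<epsilon> / 4)"
        using a ar by (intro mult_mono) auto
      also have "f a * \<alpha> < (1 + \<epsilon> / 2) * \<alpha>"
        using a \<open>0 < \<alpha>\<close> by simp
      also have "(1 + \<epsilon> / 2) * \<alpha> \<le> \<alpha> + \<epsilon> / 2"
        using \<open>\<alpha> < 1\<close> \<open>\<epsilon> > 0\<close> by (simp add: distrib_right)
      finally show ?thesis by simp
    qed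
    \<comment> \<open>The implication holds for every m, not only eventually.\<close>
    then show ?thesis
      using \<open>\<eta> > 0\<close> by (intro exI[of _ \<eta>] conjI always_eventually allI impI)
  qed
  show ?thesis
  proof (intro conjI impI)
    assume "little_o_P_1 M
      (\<lambda>m \<omega>. ereal (sqrt (real m * ln (ln (real m)))) / ereal (real (rhat m \<omega>)))"
    from this fin meas freed show "LF_m_consistent M \<alpha>
        (\<lambda>m \<omega>. FDP_Freed \<alpha> \<delta> s lam m (\<pi> m) (\<lambda>i. p m i \<omega>))"
      by (rule LF_m_consistentI)
  next
    assume "little_o_P_1 M (\<lambda>m \<omega>. 1 / ereal (real (rhat m \<omega>)))"
    from this fin meas kru show "LF_m_consistent M \<alpha>
        (\<lambda>m \<omega>. FDP_KRU \<alpha> \<delta> s lam m (\<pi> m) (\<lambda>i. p m i \<omega>))"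
      by (rule LF_m_consistentI)
  qed
qed

end
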